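(* Let $E$ be a Banach space containing an open cone $C$ such that $\overline{C}$ is a normal cone. Then the stochastic order on $\mathcal{P}(C)$ is a partial order.
   Context: $E$ is a real Banach space and $C\subseteq E$ is a nonempty open (convex) cone whose closure $\overline C$ is a proper cone, i.e. $\overline C\cap(-\overline C)=\{0\}$. The closed partial order on $E$ is $x\le y$ iff $y-x\in\overline C$, and $C$ carries its restriction. $\overline C$ is normal if there is a constant $K$ such that $0\le x\le y$ implies $\|x\|\le K\|y\|$. $E$ is not assumed separable. $C$ carries the (norm) topology inherited from $E$. $\mathcal{P}(C)$ denotes the set of Borel probability measures $\mu$ on $C$ satisfying the following conditions (which depend only on the topology of $C$ and are equivalent here because $C$ is completely metrizable): the support of $\mu$ has measure $1$; $\mu$ is $\tau$-additive, i.e. $\mu(U)=\sup_\alpha\mu(U_\alpha)$ for every directed union $U=\bigcup_\alpha U_\alpha$ of open sets; $\mu$ is the weak limit of a sequence of finitely supported measures; $\mu$ is inner regular, i.e. for every Borel set $A$ and $\varepsilon>0$ there is a compact $K\subseteq A$ with $\mu(A)-\varepsilon<\mu(K)$. A subset $A\subseteq C$ is an upper set if $x\in A$, $y\in C$ and $x\le y$ imply $y\in A$. The stochastic order on $\mathcal{P}(C)$: $\mu\le\nu$ if $\mu(U)\le\nu(U)$ for each open upper set $U\subseteq C$. *)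

theory Defs
  imports "HOL-Probability.Probability"
begin

(* Only positive scalars are used: the library predicates cone, conic and convex_cone
   force 0 into the set, which an open cone with proper closure never satisfies
   (unless the space is trivial). *)
definition open_convex_cone :: "'a::real_normed_vector set \<Rightarrow> bool" where
  "open_convex_cone C \<longleftrightarrow>
     C \<noteq> {} \<and> open C \<and> convex C \<and> (\<forall>x\<in>C. \<forall>t::real. t > 0 \<longrightarrow> t *\<^sub>R x \<in> C)"

definition proper_cone :: "'a::real_normed_vector set \<Rightarrow> bool" where
  "proper_cone K \<longleftrightarrow> K \<inter> uminus ` K = {0}"

definition cone_le :: "'a::real_normed_vector set \<Rightarrow> 'a \<Rightarrow> 'a \<Rightarrow> bool" where
  "cone_le K x y \<longleftrightarrow> y - x \<in> K"

definition normal_cone :: "'a::real_normed_vector set \<Rightarrow> bool" where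
  "normal_cone K \<longleftrightarrow>
     (\<exists>c::real. \<forall>x y. cone_le K 0 x \<and> cone_le K x y \<longrightarrow> norm x \<le> c * norm y)"

definition borel_prob_on :: "'a::topological_space set \<Rightarrow> 'a measure \<Rightarrow> bool" where
  "borel_prob_on C M \<longleftrightarrow> prob_space M \<and> sets M = sets (restrict_space borel C)"

definition measure_support :: "'a::topological_space set \<Rightarrow> 'a measure \<Rightarrow> 'a set" where
  "measure_support C M =
     {x \<in> C. \<forall>U. openin (top_of_set C) U \<and> x \<in> U \<longrightarrow> emeasure M U > 0}"

definition tau_additive :: "'a::topological_space set \<Rightarrow> 'a measure \<Rightarrow> bool" where
  "tau_additive C M \<longleftrightarrow>
     (\<forall>\<U>. \<U> \<noteq> {} \<and> (\<forall>U\<in>\<U>. openin (top_of_set C) U) \<and>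
          (\<forall>U\<in>\<U>. \<forall>V\<in>\<U>. \<exists>W\<in>\<U>. U \<union> V \<subseteq> W)
        \<longrightarrow> emeasure M (\<Union>\<U>) = (SUP U\<in>\<U>. emeasure M U))"

definition finitely_supported_on :: "'a::topological_space set \<Rightarrow> 'a measure \<Rightarrow> bool" where
  "finitely_supported_on C M \<longleftrightarrow>
     borel_prob_on C M \<and> (\<exists>F. finite F \<and> F \<subseteq> C \<and> emeasure M F = 1)"

(* Convergence against bounded continuous functions; the library's weak_conv_m is
   defined through distribution functions and covers only measures on the real line. *)
definition weak_limit_on ::
    "'a::topological_space set \<Rightarrow> (nat \<Rightarrow> 'a measure) \<Rightarrow> 'a measure \<Rightarrow> bool" where
  "weak_limit_on C N M \<longleftrightarrow>
     (\<forall>f :: 'a \<Rightarrow> real. continuous_on C f \<and> bounded (f ` C) \<longrightarrow>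
        (\<lambda>n. integral\<^sup>L (N n) f) \<longlonglongrightarrow> integral\<^sup>L M f)"

definition inner_regular :: "'a::topological_space measure \<Rightarrow> bool" where
  "inner_regular M \<longleftrightarrow>
     (\<forall>A\<in>sets M. \<forall>\<epsilon>::real. \<epsilon> > 0 \<longrightarrow>
        (\<exists>K. compact K \<and> K \<subseteq> A \<and> measure M A - \<epsilon> < measure M K))"

definition Prob_on :: "'a::topological_space set \<Rightarrow> 'a measure set" where
  "Prob_on C = {M. borel_prob_on C M \<and>
     emeasure M (measure_support C M) = 1 \<and>
     tau_additive C M \<and>
     (\<exists>N. (\<forall>n. finitely_supported_on C (N n)) \<and> weak_limit_on C N M) \<and>
     inner_regular M}"

definition upper_set_in :: "'a::real_normed_vector set \<Rightarrow> 'a set \<Rightarrow> bool" where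
  "upper_set_in C A \<longleftrightarrow>
     A \<subseteq> C \<and> (\<forall>x\<in>A. \<forall>y\<in>C. cone_le (closure C) x y \<longrightarrow> y \<in> A)"

definition stochastic_le :: "'a::real_normed_vector set \<Rightarrow> 'a measure \<Rightarrow> 'a measure \<Rightarrow> bool" where
  "stochastic_le C M N \<longleftrightarrow>
     (\<forall>U. openin (top_of_set C) U \<and> upper_set_in C U \<longrightarrow> emeasure M U \<le> emeasure N U)"

definition stochastic_order :: "'a::real_normed_vector set \<Rightarrow> ('a measure \<times> 'a measure) set" where
  "stochastic_order C = {(M, N). M \<in> Prob_on C \<and> N \<in> Prob_on C \<and> stochastic_le C M N}"

end

theory Submission
  imports Defs
begin

text \<open>
  Two measures that agree on all open upper sets agree on the \<open>\<sigma>\<close>-algebra \<open>S\<close> that these sets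
  generate. If \<open>y - x\<close> is not in the closure of \<open>C\<close>, then for \<open>u\<close> in \<open>C\<close> and small \<open>e > 0\<close> the open
  upper set of all \<open>z\<close> with \<open>z - x + e u \<in> C\<close> is a neighbourhood of \<open>x\<close> whose complement is a
  neighbourhood of \<open>y\<close>. By compactness, any two disjoint compact sets are separated by a member
  of \<open>S\<close>, and inner regularity then forces the two measures to agree on compact sets, hence
  everywhere.
\<close>

section \<open>Addition in an open cone and its closure\<close>

lemma open_convex_cone_add:
  assumes "open_convex_cone C" "x \<in> C" "y \<in> C"
  shows "x + y \<in> C"
proof -
  have "(1/2) *\<^sub>R x + (1/2) *\<^sub>R y \<in> C"
    using assms by (intro convexD) (auto simp: open_convex_cone_def)
  then have "2 *\<^sub>R ((1/2) *\<^sub>R x + (1/2) *\<^sub>R y) \<in> C"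
    using assms(1) unfolding open_convex_cone_def by fastforce
  then show ?thesis
    by (simp add: scaleR_add_right)
qed

text \<open>Openness leaves room around \<open>x\<close>: replace \<open>y\<close> by a nearby
  \<open>y'\<close> in \<open>C\<close> and absorb the error \<open>y - y'\<close> into
  \<open>x\<close>.\<close>

lemma open_convex_cone_add_closure:
  fixes C :: "'a::real_normed_vector set"
  assumes C: "open_convex_cone C" and "x \<in> C" "y \<in> closure C"
  shows "x + y \<in> C"
proof -
  have "open C"
    using C by (simp add: open_convex_cone_def)
  then obtain e where e: "e > 0" "ball x e \<subseteq> C"
    using \<open>x \<in> C\<close> open_contains_ball by blast
  obtain y' where y': "y' \<in> C" "dist y' y < e"
    using \<open>y \<in> closure C\<close> e(1) closure_approachable by blast
  have "x + (y - y') \<in> C"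
    using y'(2) e(2) by (auto simp: subset_iff dist_norm algebra_simps)
  from open_convex_cone_add[OF C this y'(1)] show ?thesis
    by simp
qed

section \<open>Open upper sets and separation of points\<close>

definition open_upper_sets :: "'a::real_normed_vector set \<Rightarrow> 'a set set" where
  "open_upper_sets C = {U. openin (top_of_set C) U \<and> upper_set_in C U}"

lemma Int_stable_open_upper_sets: "Int_stable (open_upper_sets C)"
  unfolding Int_stable_def open_upper_sets_def upper_set_in_def by (blast intro: openin_Int)

lemma carrier_in_open_upper_sets: "C \<in> open_upper_sets C"
  by (auto simp: open_upper_sets_def upper_set_in_def)

lemma open_upper_sets_subset: "open_upper_sets C \<subseteq> Pow C"
  by (auto simp: open_upper_sets_def upper_set_in_def)

lemma open_upper_sets_borel: "open_upper_sets C \<subseteq> sets (restrict_space borel C)"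
  by (auto simp: open_upper_sets_def openin_open sets_restrict_space)

lemma separating_open_upper_set:
  fixes C :: "'a::real_normed_vector set"
  assumes C: "open_convex_cone C" and "x \<in> C" and "\<not> cone_le (closure C) x y"
  obtains U V where "U \<in> open_upper_sets C" "open U" "open V" "x \<in> U" "y \<in> V" "U \<inter> V = {}"
proof -
  have "open C"
    using C by (simp add: open_convex_cone_def)
  obtain u where u: "u \<in> C"
    using C by (auto simp: open_convex_cone_def)
  \<comment> \<open>The complement of \<open>closure C\<close> is open, so \<open>y - x\<close>
    stays in it under small perturbations. The right-sided filter yields \<open>e > 0\<close>, which
    puts \<open>e *\<^sub>R u\<close> in \<open>C\<close>.\<close>
  have "isCont (\<lambda>e. y - x + e *\<^sub>R u) (0::real)"
    by (intro continuous_intros)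
  then have "((\<lambda>e. y - x + e *\<^sub>R u) \<longlongrightarrow> y - x) (at_right 0)"
    by (auto simp: isCont_def intro: tendsto_within_subset)
  then have "\<forall>\<^sub>F e in at_right 0. y - x + e *\<^sub>R u \<in> - closure C"
    using assms(3) by (intro topological_tendstoD) (auto simp: cone_le_def)
  then have "\<forall>\<^sub>F e in at_right 0. y - x + e *\<^sub>R u \<in> - closure C \<and> e > (0::real)"
    using eventually_at_right_less[of "0::real"] by (rule eventually_conj)
  then obtain e :: real where e: "e > 0" "y - x + e *\<^sub>R u \<notin> closure C"
    using eventually_happens'[OF trivial_limit_at_right_real] by (metis (mono_tags, lifting) ComplD)
  \<comment> \<open>The shift sends \<open>x\<close> to \<open>e *\<^sub>R u\<close>, a point of
    \<open>C\<close>; without it \<open>x\<close> would go to 0, which need not lie in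
    \<open>C\<close>.\<close>
  define s where "s z = z - x + e *\<^sub>R u" for z
  have s: "continuous_on UNIV s"
    unfolding s_def by (intro continuous_intros)
  define U where "U = C \<inter> s -` C"
  define V where "V = s -` (- closure C)"
  have "open U"
    unfolding U_def by (intro open_Int open_vimage \<open>open C\<close> s)
  have "upper_set_in C U"
    unfolding upper_set_in_def
  proof (intro conjI ballI impI)
    fix z w assume z: "z \<in> U" and "w \<in> C" "cone_le (closure C) z w"
    \<comment> \<open>Here \<open>s w = s z + (w - z)\<close>, a point of \<open>C\<close> plus a
      point of \<open>closure C\<close>.\<close>
    then have "s z + (w - z) \<in> C"
      by (intro open_convex_cone_add_closure[OF C]) (auto simp: U_def cone_le_def)
    with \<open>w \<in> C\<close> show "w \<in> U"
      by (simp add: U_def s_def algebra_simps)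
  qed (auto simp: U_def)
  moreover have "openin (top_of_set C) U"
    using \<open>open U\<close> by (simp add: openin_open_eq[OF \<open>open C\<close>] U_def)
  ultimately have "U \<in> open_upper_sets C"
    by (simp add: open_upper_sets_def)
  moreover have "open V"
    unfolding V_def by (intro open_vimage s open_Compl closed_closure)
  moreover have "x \<in> U"
    using u e(1) C \<open>x \<in> C\<close> by (auto simp: U_def s_def open_convex_cone_def)
  moreover have "y \<in> V"
    using e(2) by (auto simp: V_def s_def)
  moreover have "U \<inter> V = {}"
    using closure_subset[of C] by (auto simp: U_def V_def)
  ultimately show ?thesis
    using that \<open>open U\<close> by blast
qed

section \<open>From separated points to separated compact sets\<close>

lemma separate_point_compact:
  fixes K :: "'a::topological_space set"
  assumes "sigma_algebra \<Omega> M" and "compact K"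
    and sep: "\<And>x. x \<in> K \<Longrightarrow> \<exists>B U V. B \<in> M \<and> open U \<and> open V \<and> x \<in> U \<and> y \<in> V \<and> U \<inter> \<Omega> \<subseteq> B \<and> V \<inter> B = {}"
  shows "\<exists>B V. B \<in> M \<and> open V \<and> y \<in> V \<and> K \<inter> \<Omega> \<subseteq> B \<and> V \<inter> B = {}"
proof -
  interpret sigma_algebra \<Omega> M by fact
  obtain B U V where BUV: "\<And>x. x \<in> K \<Longrightarrow>
      B x \<in> M \<and> open (U x) \<and> open (V x) \<and> x \<in> U x \<and> y \<in> V x \<and> U x \<inter> \<Omega> \<subseteq> B x \<and> V x \<inter> B x = {}"
    using sep by metis
  have "\<And>x. x \<in> K \<Longrightarrow> open (U x)" "K \<subseteq> (\<Union>x\<in>K. U x)"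
    using BUV by auto
  then obtain F where F: "F \<subseteq> K" "finite F" "K \<subseteq> (\<Union>x\<in>F. U x)"
    using compactE_image[OF \<open>compact K\<close>] by metis
  have "(\<Union>x\<in>F. B x) \<in> M"
    using F(1,2) BUV by (intro finite_UN) auto
  moreover have "open (\<Inter>x\<in>F. V x)"
    using F(1,2) BUV by (intro open_INT) auto
  moreover have "y \<in> (\<Inter>x\<in>F. V x)"
    using F(1) BUV by auto
  moreover have "K \<inter> \<Omega> \<subseteq> (\<Union>x\<in>F. B x)"
  proof
    fix z assume "z \<in> K \<inter> \<Omega>"
    then obtain x where "x \<in> F" "z \<in> U x \<inter> \<Omega>"
      using F(3) by auto
    then show "z \<in> (\<Union>x\<in>F. B x)"
      using BUV F(1) by blast
  qed
  moreover have "(\<Inter>x\<in>F. V x) \<inter> (\<Union>x\<in>F. B x) = {}"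
    using F(1) BUV by blast
  ultimately show ?thesis
    by blast
qed

text \<open>The same compactness argument in the other variable: cover \<open>L\<close> by finitely
  many \<open>V y\<close> and intersect the corresponding \<open>B y\<close>.\<close>

lemma separate_compact_compact:
  fixes K L :: "'a::topological_space set"
  assumes "sigma_algebra \<Omega> M" and "compact K" "compact L" "K \<subseteq> \<Omega>"
    and sep: "\<And>x y. x \<in> K \<Longrightarrow> y \<in> L \<Longrightarrow>
      \<exists>B U V. B \<in> M \<and> open U \<and> open V \<and> x \<in> U \<and> y \<in> V \<and> U \<inter> \<Omega> \<subseteq> B \<and> V \<inter> B = {}"
  shows "\<exists>B\<in>M. K \<subseteq> B \<and> L \<inter> B = {}"
proof -
  interpret sigma_algebra \<Omega> M by fact
  have "\<exists>B V. B \<in> M \<and> open V \<and> y \<in> V \<and> K \<inter> \<Omega> \<subseteq> B \<and> V \<inter> B = {}" if "y \<in> L" for y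
    by (rule separate_point_compact[OF assms(1,2)]) (rule sep[OF _ that])
  then obtain B V where BV: "\<And>y. y \<in> L \<Longrightarrow>
      B y \<in> M \<and> open (V y) \<and> y \<in> V y \<and> K \<inter> \<Omega> \<subseteq> B y \<and> V y \<inter> B y = {}"
    by metis
  have "\<And>y. y \<in> L \<Longrightarrow> open (V y)" "L \<subseteq> (\<Union>y\<in>L. V y)"
    using BV by auto
  then obtain F where F: "F \<subseteq> L" "finite F" "L \<subseteq> (\<Union>y\<in>F. V y)"
    using compactE_image[OF \<open>compact L\<close>] by metis
  \<comment> \<open>This is the intersection of the \<open>B y\<close>, written through complements
    so that it equals \<Omega> when \<open>F\<close> is empty.\<close>
  have "\<Omega> - (\<Union>y\<in>F. \<Omega> - B y) \<in> M"
    using F(1,2) BV by (intro compl_sets finite_UN) auto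
  moreover have "K \<subseteq> \<Omega> - (\<Union>y\<in>F. \<Omega> - B y)"
    using F(1) BV \<open>K \<subseteq> \<Omega>\<close> by blast
  moreover have "L \<inter> (\<Omega> - (\<Union>y\<in>F. \<Omega> - B y)) = {}"
  proof -
    have "z \<notin> \<Omega> - (\<Union>y\<in>F. \<Omega> - B y)" if z: "z \<in> L" for z
    proof -
      obtain y where "y \<in> F" "z \<in> V y"
        using F(3) z by auto
      then show ?thesis
        using BV F(1) by blast
    qed
    then show ?thesis
      by blast
  qed
  ultimately show ?thesis
    by blast
qed

lemma cone_separate_compact:
  fixes C :: "'a::real_normed_vector set"
  assumes C: "open_convex_cone C" and "proper_cone (closure C)"
    and KL: "compact K" "compact L" "K \<subseteq> C" "L \<subseteq> C" "K \<inter> L = {}"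
  shows "\<exists>B\<in>sigma_sets C (open_upper_sets C). K \<subseteq> B \<and> L \<inter> B = {}"
proof (rule separate_compact_compact[OF _ KL(1-3)])
  show "sigma_algebra C (sigma_sets C (open_upper_sets C))"
    by (rule sigma_algebra_sigma_sets[OF open_upper_sets_subset])
  fix x y assume xy: "x \<in> K" "y \<in> L"
  then have "x \<in> C" "y \<in> C" "x \<noteq> y"
    using KL by auto
  \<comment> \<open>If both comparisons held, properness would force
    \<open>x - y = 0\<close>.\<close>
  have "\<not> cone_le (closure C) x y \<or> \<not> cone_le (closure C) y x"
  proof (rule ccontr)
    assume *: "\<not> ?thesis"
    then have "x - y \<in> uminus ` closure C"
      by (auto simp: cone_le_def intro!: image_eqI[of _ _ "y - x"])
    with * have "x - y \<in> closure C \<inter> uminus ` closure C"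
      by (auto simp: cone_le_def)
    with \<open>proper_cone (closure C)\<close> \<open>x \<noteq> y\<close> show False
      by (simp add: proper_cone_def)
  qed
  then show "\<exists>B U V. B \<in> sigma_sets C (open_upper_sets C) \<and> open U \<and> open V \<and>
      x \<in> U \<and> y \<in> V \<and> U \<inter> C \<subseteq> B \<and> V \<inter> B = {}"
  proof
    assume "\<not> cone_le (closure C) x y"
    then obtain U V where "U \<in> open_upper_sets C" "open U" "open V" "x \<in> U" "y \<in> V" "U \<inter> V = {}"
      by (rule separating_open_upper_set[OF C \<open>x \<in> C\<close>])
    then show ?thesis
      by (intro exI[of _ U] exI[of _ V]) auto
  next
    assume "\<not> cone_le (closure C) y x"
    then obtain U V where "U \<in> open_upper_sets C" "open U" "open V" "y \<in> U" "x \<in> V" "U \<inter> V = {}"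
      by (rule separating_open_upper_set[OF C \<open>y \<in> C\<close>])
    then show ?thesis
      \<comment> \<open>Now the open upper set contains \<open>y\<close>, so its complement in
        \<open>C\<close> separates and the two neighbourhoods swap roles.\<close>
      by (intro exI[of _ "C - U"] exI[of _ V] exI[of _ U]) (auto intro: sigma_sets.Compl)
  qed
qed

section \<open>Criteria for comparing two measures\<close>

text \<open>Dynkin's \<pi>-\<lambda> argument; \<open>space M \<in> G\<close> supplies equal total
  masses for the complement step.\<close>

lemma emeasure_eq_sigma_sets:
  assumes "finite_measure M" "space N = space M" "sets N = sets M"
    and G: "Int_stable G" "G \<subseteq> sets M" "space M \<in> G"
    and eq: "\<And>A. A \<in> G \<Longrightarrow> emeasure M A = emeasure N A"
    and "A \<in> sigma_sets (space M) G"
  shows "emeasure M A = emeasure N A"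
proof -
  have GP: "G \<subseteq> Pow (space M)"
    using G(2) sets.space_closed by blast
  have sub: "sigma_sets (space M) G \<subseteq> sets M"
    using G(2) by (rule sets.sigma_sets_subset)
  have fin: "emeasure M B \<noteq> \<infinity>" for B
    using finite_measure.emeasure_finite[OF \<open>finite_measure M\<close>] by simp
  show ?thesis
    using G(1) GP \<open>A \<in> sigma_sets (space M) G\<close>
  proof (induction rule: sigma_sets_induct_disjoint)
    case (compl A)
    then have A: "A \<in> sets M" using sub by auto
    \<comment> \<open>Finiteness is assumed of \<open>M\<close> only; for \<open>N\<close> it comes
      from the induction hypothesis.\<close>
    have "emeasure N A \<noteq> \<infinity>"
      using fin compl.IH by metis
    then have "emeasure N (space N - A) = emeasure N (space N) - emeasure N A"
      using A assms(3) by (intro emeasure_compl) auto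
    moreover have "emeasure M (space M - A) = emeasure M (space M) - emeasure M A"
      using A fin by (intro emeasure_compl) auto
    ultimately show ?case
      using eq[OF G(3)] compl.IH assms(2) by simp
  next
    case (union A)
    have "range A \<subseteq> sets M" using union sub by auto
    then have "emeasure M (\<Union>i. A i) = (\<Sum>i. emeasure M (A i))"
      "emeasure N (\<Union>i. A i) = (\<Sum>i. emeasure N (A i))"
      using union(1) assms(3) by (auto intro!: suminf_emeasure[symmetric])
    then show ?case using union by simp
  qed (auto simp: eq)
qed

text \<open>Approximate \<open>A\<close> from inside by \<open>K\<close> for \<open>M\<close>, and
  its complement by \<open>L\<close> for \<open>N\<close>, each up to \<open>e/2\<close>. A set
  \<open>B\<close> between \<open>K\<close> and the complement of \<open>L\<close> on which the
  measures agree gives \<open>measure M K \<le> 1 - measure N L\<close>.\<close>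

lemma inner_regular_measure_le:
  assumes "prob_space M" "prob_space N" "sets N = sets M"
    and "inner_regular M" "inner_regular N"
    and compact_sets: "\<And>K. compact K \<Longrightarrow> K \<subseteq> space M \<Longrightarrow> K \<in> sets M"
    and sep: "\<And>K L. compact K \<Longrightarrow> compact L \<Longrightarrow> K \<subseteq> space M \<Longrightarrow> L \<subseteq> space M \<Longrightarrow> K \<inter> L = {} \<Longrightarrow>
      \<exists>B\<in>sets M. measure M B = measure N B \<and> K \<subseteq> B \<and> L \<inter> B = {}"
    and "A \<in> sets M"
  shows "measure M A \<le> measure N A"
proof -
  interpret M: prob_space M by fact
  interpret N: prob_space N by fact
  have sp: "space N = space M"
    using \<open>sets N = sets M\<close> by (rule sets_eq_imp_space_eq)
  have A: "A \<in> sets N" "A \<subseteq> space M"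
    using assms(3) \<open>A \<in> sets M\<close> sets.sets_into_space by auto
  have "measure M A \<le> measure N A + e" if "e > 0" for e
  proof -
    obtain K where K: "compact K" "K \<subseteq> A" "measure M A - e/2 < measure M K"
      using \<open>inner_regular M\<close> \<open>A \<in> sets M\<close> \<open>e > 0\<close> unfolding inner_regular_def
      by (meson half_gt_zero)
    have "space N - A \<in> sets N"
      using A by auto
    then obtain L where L: "compact L" "L \<subseteq> space N - A" "measure N (space N - A) - e/2 < measure N L"
      using \<open>inner_regular N\<close> \<open>e > 0\<close> unfolding inner_regular_def by (meson half_gt_zero)
    have KL: "K \<subseteq> space M" "L \<subseteq> space M" "K \<inter> L = {}"
      using K(2) L(2) A sp by auto
    then obtain B where B: "B \<in> sets M" "measure M B = measure N B" "K \<subseteq> B" "L \<inter> B = {}"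
      using sep[OF K(1) L(1) KL] by auto
    have L': "L \<in> sets N"
      using compact_sets L(1) \<open>L \<subseteq> space M\<close> assms(3) by simp
    have "measure M K \<le> measure M B"
      using B by (intro M.finite_measure_mono)
    also have "\<dots> = measure N B" by fact
    also have "\<dots> \<le> measure N (space N - L)"
      using B L' assms(3) sets.sets_into_space[OF \<open>B \<in> sets M\<close>] sp
      by (intro N.finite_measure_mono) auto
    also have "\<dots> = 1 - measure N L"
      using L' by (rule N.prob_compl)
    also have "\<dots> \<le> measure N A + e/2"
      using L(3) N.prob_compl[OF A(1)] by simp
    finally show ?thesis
      using K(3) by simp
  qed
  then show ?thesis
    by (rule field_le_epsilon)
qed

section \<open>The order axioms\<close>

lemma stochastic_le_antisym:
  fixes C :: "'a::real_normed_vector set"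
  assumes C: "open_convex_cone C" "proper_cone (closure C)"
    and M: "M \<in> Prob_on C" and N: "N \<in> Prob_on C"
    and le: "stochastic_le C M N" "stochastic_le C N M"
  shows "M = N"
proof -
  have sets: "sets M = sets (restrict_space borel C)" "sets N = sets M"
    and prob: "prob_space M" "prob_space N"
    and reg: "inner_regular M" "inner_regular N"
    using M N by (auto simp: Prob_on_def borel_prob_on_def)
  interpret M: prob_space M by (fact prob)
  interpret N: prob_space N by (fact prob)
  have sp: "space M = C" "space N = C"
    using sets_eq_imp_space_eq[OF sets(1)] sets_eq_imp_space_eq[OF sets(2)]
    by (auto simp: space_restrict_space)
  have upper: "open_upper_sets C \<subseteq> sets M"
    using open_upper_sets_borel sets(1) by blast
  have sigma: "sigma_sets C (open_upper_sets C) \<subseteq> sets M"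
    using sets.sigma_sets_subset[OF upper] sp by simp
  have "emeasure M A = emeasure N A" if "A \<in> sigma_sets C (open_upper_sets C)" for A
  proof (rule emeasure_eq_sigma_sets)
    show "emeasure M U = emeasure N U" if "U \<in> open_upper_sets C" for U
      using le that by (auto simp: stochastic_le_def open_upper_sets_def intro: antisym)
  qed (use sp sets upper that in
      \<open>auto simp: Int_stable_open_upper_sets carrier_in_open_upper_sets M.finite_measure_axioms\<close>)
  then have agree: "measure M A = measure N A" if "A \<in> sigma_sets C (open_upper_sets C)" for A
    using that by (simp add: measure_def)
  \<comment> \<open>A compact set is closed in the whole space, hence Borel, and inside
    \<open>C\<close> it is its own trace on \<open>C\<close>.\<close>
  have compact_sets: "K \<in> sets M" if "compact K" "K \<subseteq> C" for K
    using that by (auto simp: sets(1) sets_restrict_space intro!: image_eqI[of _ _ K]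
        borel_closed compact_imp_closed)
  have sep: "\<exists>B\<in>sets M. measure M B = measure N B \<and> K \<subseteq> B \<and> L \<inter> B = {}"
    if "compact K" "compact L" "K \<subseteq> C" "L \<subseteq> C" "K \<inter> L = {}" for K L
    using cone_separate_compact[OF C that] agree sigma by blast
  show "M = N"
  proof (rule measure_eqI)
    fix A assume A: "A \<in> sets M"
    have "measure M A \<le> measure N A"
      by (rule inner_regular_measure_le[OF prob sets(2) reg _ _ A]) (use sp compact_sets sep in auto)
    \<comment> \<open>The hypotheses are symmetric in the two measures, so the one-sided comparison
      applies with them exchanged.\<close>
    moreover have "measure N A \<le> measure M A"
      by (rule inner_regular_measure_le[OF prob(2,1) sets(2)[symmetric] reg(2,1)])
        (use sp sets(2) compact_sets sep A in \<open>auto simp: eq_commute\<close>)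
    ultimately show "emeasure M A = emeasure N A"
      by (simp add: M.emeasure_eq_measure N.emeasure_eq_measure)
  qed (simp add: sets)
qed

theorem theorem4p3:
  fixes C :: "'a::banach set"
  assumes "open_convex_cone C"
    and "proper_cone (closure C)"
    and "normal_cone (closure C)"
  shows "partial_order_on (Prob_on C) (stochastic_order C)"
proof -
  \<comment> \<open>Reflexivity and transitivity are inherited setwise from the order on the values
    of the measures.\<close>
  have "refl_on (Prob_on C) (stochastic_order C)"
    by (auto simp: refl_on_def stochastic_order_def stochastic_le_def)
  moreover have "stochastic_order C \<subseteq> Prob_on C \<times> Prob_on C"
    by (auto simp: stochastic_order_def)
  moreover have "trans (stochastic_order C)"
    by (auto simp: trans_def stochastic_order_def stochastic_le_def intro: order_trans)
  moreover have "antisym (stochastic_order C)"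
    using stochastic_le_antisym[OF assms(1,2)] by (auto simp: antisym_def stochastic_order_def)
  ultimately show ?thesis
    by (simp add: partial_order_on_def preorder_on_def)
qed

end
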